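(* Let $a$ and $b$ be real numbers such that $0<b\le a<\infty$, and define $$P_{a,b}:=\begin{cases} 1 & \text{if } ab\le 1,\\[4pt] \dfrac{4+(a-b)^2}{(a+b)^2} & \text{if } \dfrac{(a-b)b}{2}\le 1\le ab,\\[8pt] \dfrac{1}{1+b^2} & \text{if } 1\le \dfrac{(a-b)b}{2}.\end{cases}$$ Then for every real-valued random variable $X$ with $\mathsf{E}X=0$ and $\mathsf{Var}\,X=1$, $$\mathsf{P}\big(X\notin(-a,b)\big)\le P_{a,b},$$ and this upper bound is exact, that is, $P_{a,b}$ is the least upper bound of $\mathsf{P}\big(X\notin(-a,b)\big)$ over all real-valued random variables $X$ (on arbitrary probability spaces) with $\mathsf{E}X=0$ and $\mathsf{Var}\,X=1$. Moreover, in all three cases of the definition of $P_{a,b}$, for every such $X$, $$\mathsf{P}\big(X\notin(-a,b)\big)\le \min\left(1,\ \frac{4+(a-b)^2}{(a+b)^2}\right).$$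
   Context: $\mathsf{P}$, $\mathsf{E}$ and $\mathsf{Var}$ denote probability, expectation and variance. $(-a,b)$ is the open interval from $-a$ to $b$. The three cases in the definition of $P_{a,b}$ cover all $0<b\le a<\infty$, and the corresponding expressions agree wherever two of the cases overlap. *)

theory Defs
  imports "HOL-Probability.Probability"
begin

(* In the library an integral is 0 when it does not exist, so existence of the first two
   moments is required explicitly. *)
definition standardized_rv :: "'w measure \<Rightarrow> ('w \<Rightarrow> real) \<Rightarrow> bool" where
  "standardized_rv M X \<longleftrightarrow>
     prob_space M \<and> X \<in> borel_measurable M \<and>
     integrable M X \<and> integrable M (\<lambda>w. (X w)\<^sup>2) \<and>
     prob_space.expectation M X = 0 \<and> prob_space.variance M X = 1"

(* For 0 < b \<le> a. The three case conditions overlap on their boundaries; the lemmas below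
   show that each expression is valid on its whole closed region, so the order of the tests
   is immaterial. *)
definition P_bound :: "real \<Rightarrow> real \<Rightarrow> real" where
  "P_bound a b =
     (if a * b \<le> 1 then 1
      else if (a - b) * b / 2 \<le> 1 then (4 + (a - b)\<^sup>2) / (a + b)\<^sup>2
      else 1 / (1 + b\<^sup>2))"

lemma P_bound_case1:
  assumes "a * b \<le> 1"
  shows "P_bound a b = 1"
  using assms by (simp add: P_bound_def)

lemma P_bound_case2:
  assumes "0 < b" "b \<le> a" "(a - b) * b / 2 \<le> 1" "1 \<le> a * b"
  shows "P_bound a b = (4 + (a - b)\<^sup>2) / (a + b)\<^sup>2"
proof (cases "a * b = 1")
  case True
  have "4 + (a - b)\<^sup>2 = (a + b)\<^sup>2"
    using True by (simp add: power2_eq_square algebra_simps)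
  moreover have "(a + b)\<^sup>2 \<noteq> 0"
    using assms by simp
  ultimately show ?thesis
    using True by (simp add: P_bound_def)
next
  case False
  then show ?thesis
    using assms by (simp add: P_bound_def)
qed

lemma P_bound_case3:
  assumes "0 < b" "b \<le> a" "1 \<le> (a - b) * b / 2"
  shows "P_bound a b = 1 / (1 + b\<^sup>2)"
proof -
  have ab: "a * b = (a - b) * b + b\<^sup>2"
    by (simp add: power2_eq_square algebra_simps)
  have gt: "1 < a * b"
  proof -
    have "2 \<le> (a - b) * b" "0 \<le> b\<^sup>2"
      using assms(3) by simp_all
    then show ?thesis
      unfolding ab by linarith
  qed
  show ?thesis
  proof (cases "(a - b) * b / 2 = 1")
    case True
    then have a: "a = b + 2 / b"
      using assms(1) by (simp add: field_simps)
    have "(4 + (a - b)\<^sup>2) = 4 * (1 + b\<^sup>2) / b\<^sup>2"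
      unfolding a using assms(1) by (simp add: field_simps power2_eq_square)
    moreover have "a + b = 2 * (1 + b\<^sup>2) / b"
      unfolding a using assms(1) by (simp add: field_simps power2_eq_square)
    moreover have "(4 * s / b\<^sup>2) / (2 * s / b)\<^sup>2 = 1 / s" if "s \<noteq> 0" for s
      using that assms(1) by (simp add: field_simps power2_eq_square)
    moreover have "1 + b\<^sup>2 \<noteq> 0"
      by (simp add: add_nonneg_eq_0_iff)
    ultimately have "(4 + (a - b)\<^sup>2) / (a + b)\<^sup>2 = 1 / (1 + b\<^sup>2)"
      by metis
    then show ?thesis
      using gt True by (simp add: P_bound_def)
  next
    case False
    then show ?thesis
      using gt assms by (simp add: P_bound_def)
  qed
qed

end

theory Submission
  imports Defs
begin

text \<open>
  Both nontrivial upper bounds are instances of Markov's inequality for the square of an affine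
  function. If \<open>(u + v x)\<^sup>2\<close> is at least \<open>1\<close> outside the interval, then the probability is at
  most \<open>E (u + v X)\<^sup>2 = u\<^sup>2 + v\<^sup>2\<close> (lemma \<open>prob_le_square_affine\<close>). The parabola symmetric about
  the midpoint of the interval, equal to \<open>1\<close> at both endpoints, gives the bound of the middle
  case for all \<open>a\<close> and \<open>b\<close>. The parabola with \<open>u + v x = (1 + b x) / (1 + b\<^sup>2)\<close>, which gives
  Cantelli's one-sided inequality, is \<open>1\<close> at \<open>b\<close>; it is at least \<open>1\<close> to the left of \<open>-a\<close>
  precisely when \<open>(a - b) b / 2 \<ge> 1\<close>.

  Equality in Markov's inequality forces \<open>X\<close> to live where the parabola is \<open>0\<close> or \<open>1\<close>, and this
  dictates the extremal laws. In the middle case the law sits on \<open>-a\<close>, \<open>b\<close> and the midpoint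
  \<open>(b - a) / 2\<close>; the two inequalities that define the case say that the weights at the midpoint
  and at \<open>-a\<close> are nonnegative. In the outer cases the law sits on \<open>b\<close> and \<open>-1/b\<close>. When
  \<open>a b \<le> 1\<close> the point \<open>-1/b\<close> is itself outside the interval, so the probability is \<open>1\<close>, and
  otherwise the atom at \<open>b\<close> alone has the weight \<open>1 / (1 + b\<^sup>2)\<close> of Cantelli's bound.
\<close>

lemma prob_le_square_affine:
  fixes X :: "'w \<Rightarrow> real"
  assumes X: "standardized_rv M X"
    and S: "S \<in> sets borel" "\<And>x. x \<in> S \<Longrightarrow> 1 \<le> (u + v * x)\<^sup>2"
  shows "\<P>(w in M. X w \<in> S) \<le> u\<^sup>2 + v\<^sup>2"
proof -
  interpret prob_space M
    using X by (simp add: standardized_rv_def)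
  have [measurable]: "X \<in> borel_measurable M" "S \<in> sets borel"
    and int: "integrable M X" "integrable M (\<lambda>w. (X w)\<^sup>2)"
    and mean: "expectation X = 0" and "variance X = 1"
    using X S(1) unfolding standardized_rv_def by blast+
  then have second_moment: "expectation (\<lambda>w. (X w)\<^sup>2) = 1"
    by (simp only: mean diff_zero)
  have expand: "(u + v * X w)\<^sup>2 = u\<^sup>2 + 2 * u * v * X w + v\<^sup>2 * (X w)\<^sup>2" for w
    by (simp add: power2_eq_square algebra_simps)
  have "\<P>(w in M. X w \<in> S) = expectation (indicator {w \<in> space M. X w \<in> S})"
    by simp
  also have "\<dots> \<le> expectation (\<lambda>w. (u + v * X w)\<^sup>2)"
  proof (rule integral_mono)
    show "integrable M (\<lambda>w. (u + v * X w)\<^sup>2)"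
      unfolding expand using int by auto
  qed (auto simp: indicator_def S(2) less_top[symmetric])
  also have "\<dots> = u\<^sup>2 + v\<^sup>2"
    unfolding expand using int mean second_moment by (simp add: prob_space)
  finally show ?thesis .
qed

text \<open>The affine function here maps the interval onto \<open>(-1, 1)\<close>.\<close>

lemma prob_outside_le_midpoint:
  fixes X :: "'w \<Rightarrow> real"
  assumes "standardized_rv M X" "0 < a + b"
  shows "\<P>(w in M. X w \<notin> {-a<..<b}) \<le> (4 + (a - b)\<^sup>2) / (a + b)\<^sup>2"
proof -
  have "1 \<le> ((a - b) / (a + b) + 2 / (a + b) * x)\<^sup>2" if "x \<in> - {-a<..<b}" for x
  proof -
    have "a + b \<le> \<bar>a - b + 2 * x\<bar>"
      using that by auto
    then have "(a + b)\<^sup>2 \<le> (a - b + 2 * x)\<^sup>2"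
      using assms(2) by (simp add: abs_le_square_iff[symmetric])
    moreover have "(a - b) / (a + b) + 2 / (a + b) * x = (a - b + 2 * x) / (a + b)"
      by (simp add: add_divide_distrib)
    ultimately show ?thesis
      using assms(2) by (simp add: power_divide)
  qed
  from prob_le_square_affine[OF assms(1), of "- {-a<..<b}", OF _ this]
  have "\<P>(w in M. X w \<in> - {-a<..<b}) \<le> ((a - b) / (a + b))\<^sup>2 + (2 / (a + b))\<^sup>2"
    by simp
  also have "\<dots> = (4 + (a - b)\<^sup>2) / (a + b)\<^sup>2"
    by (simp add: power_divide add_divide_distrib)
  finally show ?thesis
    by simp
qed

text \<open>
  The hypothesis on \<open>a\<close> makes the far-left tail free of charge: the parabola of Cantelli's
  inequality, with its vertex at \<open>-1/b\<close>, has already climbed back to \<open>1\<close> at \<open>-a\<close>.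
\<close>

lemma prob_outside_le_cantelli:
  fixes X :: "'w \<Rightarrow> real"
  assumes "standardized_rv M X" "0 < b" "1 \<le> (a - b) * b / 2"
  shows "\<P>(w in M. X w \<notin> {-a<..<b}) \<le> 1 / (1 + b\<^sup>2)"
proof -
  have pos: "0 < 1 + b\<^sup>2"
    by (simp add: add_pos_nonneg)
  have "1 \<le> (1 / (1 + b\<^sup>2) + b / (1 + b\<^sup>2) * x)\<^sup>2" if "x \<in> - {-a<..<b}" for x
  proof -
    have "1 + b\<^sup>2 \<le> \<bar>1 + b * x\<bar>"
    proof (cases "b \<le> x")
      case True
      then have "b * b \<le> b * x"
        using assms(2) by simp
      then show ?thesis
        by (simp add: power2_eq_square)
    next
      case False
      then have "b * x \<le> b * (- a)"
        using that assms(2) by (intro mult_left_mono) auto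
      moreover have "2 \<le> a * b - b * b"
        using assms(3) by (simp add: algebra_simps)
      ultimately show ?thesis
        by (simp add: power2_eq_square algebra_simps)
    qed
    then have "(1 + b\<^sup>2)\<^sup>2 \<le> (1 + b * x)\<^sup>2"
      using pos by (simp add: abs_le_square_iff[symmetric])
    moreover have "1 / (1 + b\<^sup>2) + b / (1 + b\<^sup>2) * x = (1 + b * x) / (1 + b\<^sup>2)"
      by (simp add: add_divide_distrib)
    ultimately show ?thesis
      using pos by (simp add: power_divide)
  qed
  from prob_le_square_affine[OF assms(1), of "- {-a<..<b}", OF _ this]
  have "\<P>(w in M. X w \<in> - {-a<..<b}) \<le> (1 / (1 + b\<^sup>2))\<^sup>2 + (b / (1 + b\<^sup>2))\<^sup>2"
    by simp
  also have "\<dots> = (1 + b\<^sup>2) / (1 + b\<^sup>2)\<^sup>2"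
    by (simp add: power_divide add_divide_distrib)
  also have "\<dots> = 1 / (1 + b\<^sup>2)"
    by (simp add: power2_eq_square[of "1 + b\<^sup>2"])
  finally show ?thesis
    by simp
qed

text \<open>
  Extremal laws are given by finitely many atoms. The probability space is the real line itself,
  with the identity as the random variable.
\<close>

lemma standardized_rv_finite_support:
  fixes A :: "real set" and p :: "real \<Rightarrow> real"
  assumes A: "finite A" "\<And>x. x \<in> A \<Longrightarrow> 0 \<le> p x" "(\<Sum>x\<in>A. p x) = 1"
    and moments: "(\<Sum>x\<in>A. p x * x) = 0" "(\<Sum>x\<in>A. p x * x\<^sup>2) = 1"
  obtains M :: "real measure" where "standardized_rv M (\<lambda>x. x)"
    and "\<And>S. \<P>(x in M. x \<in> S) = (\<Sum>x\<in>A \<inter> S. p x)"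
proof -
  define f where "f x = (if x \<in> A then p x else 0)" for x
  have f_nonneg: "0 \<le> f x" for x
    by (simp add: f_def A)
  have "(\<integral>\<^sup>+x. ennreal (f x) \<partial>count_space UNIV) = (\<Sum>x\<in>A. ennreal (f x))"
    by (rule nn_integral_count_space') (auto simp: f_def A)
  also have "\<dots> = 1"
    using A by (simp add: sum_ennreal f_nonneg) (simp add: f_def)
  finally have total: "(\<integral>\<^sup>+x. ennreal (f x) \<partial>count_space UNIV) = 1" .
  define q where "q = embed_pmf f"
  have pmf_q: "pmf q x = f x" for x
    unfolding q_def by (rule pmf_embed_pmf[OF f_nonneg total])
  have supp: "set_pmf q \<subseteq> A"
    by (auto simp: set_pmf_iff pmf_q f_def split: if_splits)
  then have int: "integrable (measure_pmf q) g" for g :: "real \<Rightarrow> real"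
    using A(1) finite_subset integrable_measure_pmf_finite by blast
  have expect: "(\<integral>x. g x \<partial>measure_pmf q) = (\<Sum>x\<in>A. p x * g x)" for g :: "real \<Rightarrow> real"
    using supp by (subst integral_measure_pmf[OF A(1)]) (auto simp: pmf_q f_def)
  show thesis
  proof
    show "standardized_rv (measure_pmf q) (\<lambda>x. x)"
      using moments by (simp add: standardized_rv_def prob_space_measure_pmf int expect)
    show "\<P>(x in measure_pmf q. x \<in> S) = (\<Sum>x\<in>A \<inter> S. p x)" for S
    proof -
      have "\<P>(x in measure_pmf q. x \<in> S) = (\<integral>x. indicator S x \<partial>measure_pmf q)"
        by simp
      also have "\<dots> = (\<Sum>x\<in>A. if x \<in> S then p x else 0)"
        unfolding expect by (rule sum.cong) auto
      also have "\<dots> = (\<Sum>x\<in>A \<inter> S. p x)"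
        by (simp add: sum.inter_restrict[OF A(1)])
      finally show ?thesis .
    qed
  qed
qed

text \<open>
  A mean-zero law on two points has variance \<open>1\<close> exactly when the product of the points is
  \<open>-1\<close>; this is where the partner \<open>-1/b\<close> of \<open>b\<close> comes from, and centring then fixes the weights.
  The same law is extremal in both outer cases.
\<close>

lemma two_point_law:
  fixes b :: real
  assumes "0 < b"
  obtains M :: "real measure" where "standardized_rv M (\<lambda>x. x)"
    and "1 / (1 + b\<^sup>2) \<le> \<P>(x in M. x \<notin> {-a<..<b})"
    and "a * b \<le> 1 \<Longrightarrow> \<P>(x in M. x \<notin> {-a<..<b}) = 1"
proof -
  have pos: "0 < 1 + b\<^sup>2"
    by (simp add: add_pos_nonneg)
  have "- (1 / b) < 0"
    using assms by simp
  then have ne: "b \<noteq> - (1 / b)"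
    using assms by linarith
  define p where "p x = (if x = b then 1 / (1 + b\<^sup>2) else b\<^sup>2 / (1 + b\<^sup>2))" for x
  let ?A = "{b, - (1 / b)}"
  have p: "p b = 1 / (1 + b\<^sup>2)" "p (- (1 / b)) = b\<^sup>2 / (1 + b\<^sup>2)"
    using ne by (auto simp: p_def)
  have total: "(\<Sum>x\<in>?A. p x) = 1"
    using ne pos by (simp add: p add_divide_distrib[symmetric])
  have m1: "(\<Sum>x\<in>?A. p x * x) = 0"
    using ne assms by (simp add: p power2_eq_square)
  have "(\<Sum>x\<in>?A. p x * x\<^sup>2) = b\<^sup>2 / (1 + b\<^sup>2) + 1 / (1 + b\<^sup>2)"
    using ne assms by (simp add: p power2_eq_square)
  also have "\<dots> = 1"
    using pos by (simp add: add_divide_distrib[symmetric])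
  finally have m2: "(\<Sum>x\<in>?A. p x * x\<^sup>2) = 1" .
  have nonneg: "0 \<le> p x" for x
    using pos by (simp add: p_def)
  obtain M :: "real measure" where M: "standardized_rv M (\<lambda>x. x)"
    and prob: "\<And>S. \<P>(x in M. x \<in> S) = (\<Sum>x\<in>?A \<inter> S. p x)"
    using standardized_rv_finite_support[of ?A p] nonneg total m1 m2 by auto
  have prob': "\<P>(x in M. x \<notin> {-a<..<b}) = (\<Sum>x\<in>?A \<inter> - {-a<..<b}. p x)"
    using prob[of "- {-a<..<b}"] by simp
  show thesis
  proof
    have "p b = (\<Sum>x\<in>{b}. p x)"
      by simp
    also have "\<dots> \<le> (\<Sum>x\<in>?A \<inter> - {-a<..<b}. p x)"
      by (rule sum_mono2) (auto simp: nonneg)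
    finally show "1 / (1 + b\<^sup>2) \<le> \<P>(x in M. x \<notin> {-a<..<b})"
      unfolding prob' p .
    show "\<P>(x in M. x \<notin> {-a<..<b}) = 1" if "a * b \<le> 1"
    proof -
      have "a \<le> 1 / b"
        using that assms by (simp add: field_simps)
      then have "?A \<inter> - {-a<..<b} = ?A"
        by auto
      then show ?thesis
        unfolding prob' using total by simp
    qed
  qed (fact M)
qed

text \<open>
  The midpoint \<open>(b - a) / 2\<close> is where the symmetric parabola vanishes, so on this support the
  parabola coincides with the indicator of the two endpoints and Markov's inequality is an
  equality.
\<close>

lemma three_point_law:
  fixes a b :: real
  assumes ab: "0 < b" "b \<le> a" and case2: "(a - b) * b / 2 \<le> 1" "1 \<le> a * b"
  obtains M :: "real measure" where "standardized_rv M (\<lambda>x. x)"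
    and "\<P>(x in M. x \<notin> {-a<..<b}) = (4 + (a - b)\<^sup>2) / (a + b)\<^sup>2"
proof -
  define s where "s = a + b"
  define d where "d = a - b"
  define P where "P = (4 + d\<^sup>2) / s\<^sup>2"
  have s: "0 < s"
    using ab by (simp add: s_def)
  have a: "a = (s + d) / 2" and b: "b = (s - d) / 2"
    by (simp_all add: s_def d_def field_simps)
  have Ps: "P * s\<^sup>2 = 4 + d\<^sup>2"
    using s by (simp add: P_def)
  \<comment> \<open>The weights come from rescaling to \<open>Y = (2 X + d) / s\<close>, which takes the values \<open>-1\<close>, \<open>0\<close>
    and \<open>1\<close>, has mean \<open>d / s\<close> and second moment \<open>P\<close>.\<close>
  define p where
    "p x = (if x = b then (P + d / s) / 2 else if x = -a then (P - d / s) / 2 else 1 - P)" for x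
  let ?m = "- (d / 2)"
  let ?A = "{b, -a, ?m}"
  have ne: "b \<noteq> -a" "b \<noteq> ?m" "-a \<noteq> ?m"
    using s by (auto simp: a b field_simps)
  have p: "p b = (P + d / s) / 2" "p (-a) = (P - d / s) / 2" "p ?m = 1 - P"
    using ne by (auto simp: p_def)
  have d0: "0 \<le> d / s"
    using ab s by (simp add: d_def)
  have "d * s \<le> 4 + d\<^sup>2"
    using case2(1) by (simp add: s_def d_def power2_eq_square algebra_simps)
  then have "d / s \<le> P"
    using s by (simp add: P_def field_simps power2_eq_square)
  moreover have "4 + d\<^sup>2 \<le> s\<^sup>2"
    using case2(2) by (simp add: s_def d_def power2_eq_square algebra_simps)
  then have "P \<le> 1"
    using s by (simp add: P_def)
  ultimately have nonneg: "0 \<le> p x" for x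
    using d0 by (auto simp: p_def)
  have ends: "p b + p (-a) = P"
    by (simp add: p field_simps)
  have total: "(\<Sum>x\<in>?A. p x) = 1"
    using ne ends by (simp add: p)
  have sum3: "(\<Sum>x\<in>?A. g x) = g b + (g (-a) + g ?m)" for g :: "real \<Rightarrow> real"
    using ne by simp
  have m1: "(\<Sum>x\<in>?A. p x * x) = 0"
    unfolding sum3 p using s by (simp add: a b field_simps)
  have "(\<Sum>x\<in>?A. p x * x\<^sup>2) = (P * s\<^sup>2 - d\<^sup>2) / 4"
    unfolding sum3 p using s by (simp add: a b field_simps power2_eq_square)
  also have "\<dots> = 1"
    by (simp add: Ps)
  finally have m2: "(\<Sum>x\<in>?A. p x * x\<^sup>2) = 1" .
  obtain M :: "real measure" where M: "standardized_rv M (\<lambda>x. x)"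
    and prob: "\<And>S. \<P>(x in M. x \<in> S) = (\<Sum>x\<in>?A \<inter> S. p x)"
    using standardized_rv_finite_support[of ?A p] nonneg total m1 m2 by auto
  have "?A \<inter> - {-a<..<b} = {b, -a}"
    using s by (auto simp: a b)
  then have "\<P>(x in M. x \<notin> {-a<..<b}) = P"
    using prob[of "- {-a<..<b}"] ne ends by simp
  with M that show thesis
    by (simp add: P_def s_def d_def)
qed

theorem theorem1:
  fixes a b :: real
  assumes "0 < b" and "b \<le> a"
  shows
    "(\<forall>(M :: 'w measure) X. standardized_rv M X \<longrightarrow>
        \<P>(w in M. X w \<notin> {-a<..<b}) \<le> P_bound a b) \<and>
     (\<forall>c. (\<forall>(M :: real measure) X. standardized_rv M X \<longrightarrow>
              \<P>(w in M. X w \<notin> {-a<..<b}) \<le> c)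
          \<longrightarrow> P_bound a b \<le> c) \<and>
     (\<forall>(M :: 'w measure) X. standardized_rv M X \<longrightarrow>
        \<P>(w in M. X w \<notin> {-a<..<b}) \<le> min 1 ((4 + (a - b)\<^sup>2) / (a + b)\<^sup>2))"
proof (intro conjI allI impI)
  fix M :: "'w measure" and X :: "'w \<Rightarrow> real"
  assume X: "standardized_rv M X"
  then have le1: "\<P>(w in M. X w \<notin> {-a<..<b}) \<le> 1"
    by (simp add: standardized_rv_def prob_space.prob_le_1)
  have mid: "\<P>(w in M. X w \<notin> {-a<..<b}) \<le> (4 + (a - b)\<^sup>2) / (a + b)\<^sup>2"
    using prob_outside_le_midpoint[OF X] assms by simp
  show "\<P>(w in M. X w \<notin> {-a<..<b}) \<le> min 1 ((4 + (a - b)\<^sup>2) / (a + b)\<^sup>2)"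
    using le1 mid by simp
  show "\<P>(w in M. X w \<notin> {-a<..<b}) \<le> P_bound a b"
    using le1 mid prob_outside_le_cantelli[OF X assms(1), of a] by (simp add: P_bound_def)
next
  fix c :: real
  assume c: "\<forall>(M :: real measure) X. standardized_rv M X \<longrightarrow>
    \<P>(w in M. X w \<notin> {-a<..<b}) \<le> c"
  obtain M :: "real measure" where M: "standardized_rv M (\<lambda>x. x)"
    "1 / (1 + b\<^sup>2) \<le> \<P>(x in M. x \<notin> {-a<..<b})"
    "a * b \<le> 1 \<Longrightarrow> \<P>(x in M. x \<notin> {-a<..<b}) = 1"
    using two_point_law[OF assms(1)] by blast
  have two: "\<P>(x in M. x \<notin> {-a<..<b}) \<le> c"
    using c M(1) by blast
  consider "a * b \<le> 1" | "1 \<le> a * b" "(a - b) * b / 2 \<le> 1" | "1 \<le> (a - b) * b / 2"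
    by linarith
  then show "P_bound a b \<le> c"
  proof cases
    case 1
    then show ?thesis
      using two M(3) by (simp add: P_bound_case1)
  next
    case 2
    obtain N :: "real measure" where N: "standardized_rv N (\<lambda>x. x)"
      "\<P>(x in N. x \<notin> {-a<..<b}) = (4 + (a - b)\<^sup>2) / (a + b)\<^sup>2"
      using three_point_law[OF assms 2(2,1)] by blast
    have "\<P>(x in N. x \<notin> {-a<..<b}) \<le> c"
      using c N(1) by blast
    then show ?thesis
      unfolding N(2) P_bound_case2[OF assms 2(2,1)] .
  next
    case 3
    then show ?thesis
      using two M(2) by (simp add: P_bound_case3[OF assms])
  qed
qed

end
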